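(* Let $c<b<a$ be real numbers. Let $\mathbf{u}=(u,v,w)\in\mathbb{R}^3$ be a point with $u,v,w\neq 0$, and let $k_1<c<k_2<b<k_3<a$ be the parameters of the three surfaces of the confocal family $\mathbf{x}^TA_k\mathbf{x}=1$ passing through $\mathbf{u}$. Let $\ell\in\mathbb{R}\setminus\{a,b,c,k_1,k_2,k_3\}$ and consider the tangent cone from the point $\mathbf{u}$ to the surface $\mathbf{x}^TA_\ell\mathbf{x}=1$, which has equation $(\mathbf{x}-\mathbf{u})^TK_{\mathbf{u},\ell}(\mathbf{x}-\mathbf{u})=0$, where $$K_{\mathbf{u},\ell}:=A_\ell\mathbf{u}\mathbf{u}^TA_\ell+(1-\mathbf{u}^TA_\ell\mathbf{u})A_\ell.$$ Then $K_{\mathbf{u},\ell}$ has eigenvectors $A_{k_1}\mathbf{u}$, $A_{k_2}\mathbf{u}$, $A_{k_3}\mathbf{u}$, with corresponding eigenvalues $$\lambda_1=\frac{(\ell-k_2)(\ell-k_3)}{(a-\ell)(b-\ell)(c-\ell)},\quad \lambda_2=\frac{(\ell-k_1)(\ell-k_3)}{(a-\ell)(b-\ell)(c-\ell)},\quad \lambda_3=\frac{(\ell-k_1)(\ell-k_2)}{(a-\ell)(b-\ell)(c-\ell)}.$$ These eigenvalues are nonzero and distinct. If they are not all of the same sign (i.e., if $k_1<\ell<k_3$), then $(\mathbf{x}-\mathbf{u})^TK_{\mathbf{u},\ell}(\mathbf{x}-\mathbf{u})=0$ is a real non-circular cone whose planes of symmetry are the three tangent planes $\mathbf{x}^TA_{k_1}\mathbf{u}=1$,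 $\mathbf{x}^TA_{k_2}\mathbf{u}=1$ and $\mathbf{x}^TA_{k_3}\mathbf{u}=1$ at $\mathbf{u}$ to the three confocal surfaces through $\mathbf{u}$.
   Context: For $k\in\mathbb{R}\setminus\{a,b,c\}$ let $A_k$ be the diagonal matrix $\mathrm{diag}\left(\frac1{a-k},\frac1{b-k},\frac1{c-k}\right)$. The surfaces $\mathbf{x}^TA_k\mathbf{x}=\frac{x^2}{a-k}+\frac{y^2}{b-k}+\frac{z^2}{c-k}=1$ form the confocal family. For $c<b<a$ and $\mathbf{u}$ with all coordinates nonzero, there are exactly three values $k_1,k_2,k_3\in\mathbb{R}\setminus\{a,b,c\}$ of $k$ with $\mathbf{u}^TA_k\mathbf{u}=1$, and they satisfy $k_1<c<k_2<b<k_3<a$. The tangent cone from a point $\mathbf{u}$ to a quadric surface $\mathbf{x}^TA\mathbf{x}=1$ ($A$ real symmetric) consists of all $\mathbf{x}$ such that the line $t\mathbf{x}+(1-t)\mathbf{u}$ has double contact with the surface, i.e. such that the discriminant of the quadratic equation in $t$ obtained by substituting the line into the equation of the surface vanishes; equivalently $(\mathbf{x}^TA\mathbf{u}-1)^2=(\mathbf{x}^TA\mathbf{x}-1)(\mathbf{u}^TA\mathbf{u}-1)$. A cone is real if it has real points other than its apex. A circular cone with apex $\mathbf{u}$ is a set of the form $\{\mathbf{x}\in\mathbb{R}^3:(\mathbf{x}-\mathbf{u})^T(\mathbf{r}\mathbf{r}^T-(\cos^2\theta)I)(\mathbf{x}-\mathbf{u})=0\}$ with $\mathbf{r}$ a unit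 vector and $\theta\in[0,\pi/2]$. A plane of symmetry of a set is a plane such that orthogonal reflection across it maps the set to itself. *)

theory Defs
  imports "HOL-Analysis.Analysis" "HOL-Library.Quadratic_Discriminant"
begin

definition confocal_matrix :: "real \<Rightarrow> real \<Rightarrow> real \<Rightarrow> real \<Rightarrow> real^3^3" where
  "confocal_matrix a b c k =
     (\<chi> i j. if i = j then 1 / ((vector [a, b, c] :: real^3) $ i - k) else 0)"

definition quadric :: "real^'n^'n \<Rightarrow> (real^'n) set" where
  "quadric A = {x. x \<bullet> (A *v x) = 1}"

text \<open>
  The points \<open>x\<close> for which substituting \<open>t x + (1 - t) u\<close> into the equation of the quadric gives
  a quadratic in \<open>t\<close> (with coefficients \<open>p\<close>, \<open>q\<close>, \<open>r\<close>, determined by \<open>x\<close>) of discriminant zero.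
  The leading coefficient may vanish, and \<open>u\<close> itself belongs to the set.
\<close>

definition tangent_cone :: "real^'n^'n \<Rightarrow> real^'n \<Rightarrow> (real^'n) set" where
  "tangent_cone A u =
     {x. \<exists>p q r. (\<forall>t. (t *\<^sub>R x + (1 - t) *\<^sub>R u) \<bullet> (A *v (t *\<^sub>R x + (1 - t) *\<^sub>R u)) - 1
                       = p * t\<^sup>2 + q * t + r)
                \<and> discrim p q r = 0}"

text \<open>
  \<open>A u u\<^sup>T A + (1 - u\<^sup>T A u) A\<close>; the type constraint is needed because \<open>columnvector\<close> and \<open>rowvector\<close>
  leave the number of columns, respectively rows, polymorphic.
\<close>

definition tangent_cone_matrix :: "real^'n^'n \<Rightarrow> real^'n \<Rightarrow> real^'n^'n" where
  "tangent_cone_matrix A u =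
     A ** (columnvector u :: real^1^'n) ** rowvector u ** A + (1 - u \<bullet> (A *v u)) *\<^sub>R A"

definition quadratic_cone :: "real^'n^'n \<Rightarrow> real^'n \<Rightarrow> (real^'n) set" where
  "quadratic_cone K u = {x. (x - u) \<bullet> (K *v (x - u)) = 0}"

definition eigenvector_of :: "real^'n^'n \<Rightarrow> real^'n \<Rightarrow> real \<Rightarrow> bool" where
  "eigenvector_of M v ev \<longleftrightarrow> v \<noteq> 0 \<and> M *v v = ev *\<^sub>R v"

text \<open>
  Cones are two-sided: the scale factor ranges over all of \<open>\<real>\<close>, unlike in the library's \<open>cone\<close>.
\<close>

definition real_cone :: "real^'n \<Rightarrow> (real^'n) set \<Rightarrow> bool" where
  "real_cone u S \<longleftrightarrow>
     (\<forall>x\<in>S. \<forall>t::real. u + t *\<^sub>R (x - u) \<in> S) \<and> (\<exists>x\<in>S. x \<noteq> u)"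

definition circular_cone :: "(real^3) set \<Rightarrow> bool" where
  "circular_cone S \<longleftrightarrow>
     (\<exists>u r \<theta>. norm r = 1 \<and> \<theta> \<in> {0..pi / 2} \<and>
        S = quadratic_cone ((columnvector r :: real^1^3) ** rowvector r - (cos \<theta>)\<^sup>2 *\<^sub>R mat 1) u)"

definition plane_reflection :: "real^3 \<Rightarrow> real \<Rightarrow> real^3 \<Rightarrow> real^3" where
  "plane_reflection n d x = x - (2 * (x \<bullet> n - d) / (n \<bullet> n)) *\<^sub>R n"

definition symmetry_plane :: "(real^3) set \<Rightarrow> (real^3) set \<Rightarrow> bool" where
  "symmetry_plane P S \<longleftrightarrow>
     (\<exists>n d. n \<noteq> 0 \<and> P = {x. x \<bullet> n = d} \<and> plane_reflection n d ` S = S)"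

text \<open>
  The tangent plane at \<open>u\<close> to the level surface of \<open>f\<close> through \<open>u\<close>, for \<open>f\<close> with non-vanishing
  derivative at \<open>u\<close>.
\<close>

definition tangent_plane :: "(real^3 \<Rightarrow> real) \<Rightarrow> real^3 \<Rightarrow> (real^3) set" where
  "tangent_plane f u = {x. frechet_derivative f (at u) (x - u) = 0}"

end

theory Submission
  imports Defs
begin

text \<open>
  Write \<open>v\<^sub>i = A\<^bsub>k\<^sub>i\<^esub> u\<close>.  Since the matrices of a confocal family are the resolvents of one diagonal
  matrix, \<open>A\<^sub>l A\<^sub>k = (A\<^sub>l - A\<^sub>k) / (l - k)\<close> (\<open>confocal_resolvent\<close>).  Combined with \<open>u\<^sup>T A\<^sub>k u = 1\<close> this makes
  the \<open>v\<^sub>i\<close> pairwise orthogonal, and shows at once that \<open>v\<^sub>i\<close> is an eigenvector of the cone matrix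
  \<open>K\<close> for the eigenvalue \<open>(u\<^sup>T A\<^sub>l u - 1) / (l - k\<^sub>i)\<close>.  After clearing denominators, \<open>u\<^sup>T A\<^sub>l u - 1\<close> is a monic
  cubic in \<open>l\<close> with the roots \<open>k\<^sub>1, k\<^sub>2, k\<^sub>3\<close>; factoring it gives the stated eigenvalues.

  For the planes of symmetry only this matters: \<open>K\<close> is symmetric with orthogonal eigenvectors and
  distinct nonzero eigenvalues of mixed sign.  Such a cone does not lie in a union of two planes
  (\<open>two_planes_indefinite_cone\<close>).  Hence a reflection that preserves the cone fixes its apex, for
  otherwise the cone would lie in one plane.  If the reflection has normal \<open>n\<close>, then comparing the
  quadratic form with its reflected copy shows that on the cone \<open>(n \<bullet> y) (m \<bullet> y) = 0\<close>, where
  \<open>m\<close> is the component of \<open>K n\<close> orthogonal to \<open>n\<close>; so \<open>m = 0\<close> and \<open>n\<close> is an eigenvector, that is, parallel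
  to some \<open>v\<^sub>i\<close>.  Exactly three planes remain.

  A circular cone is symmetric in every plane that contains its axis, so it has infinitely many
  planes of symmetry.  This excludes circularity, degenerate opening angles included.
\<close>

section \<open>Symmetric matrices and orthogonal triples\<close>

lemma sym_matrix_inner:
  fixes M :: "real^'n^'n"
  assumes "transpose M = M"
  shows "x \<bullet> (M *v y) = (M *v x) \<bullet> y"
  by (metis assms dot_lmul_matrix vector_transpose_matrix transpose_matrix_vector)

lemma orthogonal_to_orthogonal_triple:
  fixes v1 v2 v3 x :: "real^3"
  assumes nz: "v1 \<noteq> 0" "v2 \<noteq> 0" "v3 \<noteq> 0"
    and orth: "v1 \<bullet> v2 = 0" "v1 \<bullet> v3 = 0" "v2 \<bullet> v3 = 0"
    and x: "x \<bullet> v1 = 0" "x \<bullet> v2 = 0" "x \<bullet> v3 = 0"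
  shows "x = 0"
proof (rule ccontr)
  assume "x \<noteq> 0"
  let ?B = "{x, v1, v2, v3}"
  have ne: "x \<noteq> v1" "x \<noteq> v2" "x \<noteq> v3" "v1 \<noteq> v2" "v1 \<noteq> v3" "v2 \<noteq> v3"
    using assms by auto
  have "pairwise orthogonal ?B"
    using orth x by (auto simp: pairwise_def orthogonal_def inner_commute)
  moreover have "0 \<notin> ?B" using nz \<open>x \<noteq> 0\<close> by auto
  ultimately have "independent ?B" by (rule pairwise_orthogonal_independent)
  then have "card ?B \<le> DIM(real^3)" using independent_bound by blast
  then show False using ne by simp
qed

lemma orthogonal_triple_expansion:
  fixes v1 v2 v3 x :: "real^3"
  assumes nz: "v1 \<noteq> 0" "v2 \<noteq> 0" "v3 \<noteq> 0"
    and orth: "v1 \<bullet> v2 = 0" "v1 \<bullet> v3 = 0" "v2 \<bullet> v3 = 0"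
  shows "x = (x \<bullet> v1 / (v1 \<bullet> v1)) *\<^sub>R v1 + (x \<bullet> v2 / (v2 \<bullet> v2)) *\<^sub>R v2
           + (x \<bullet> v3 / (v3 \<bullet> v3)) *\<^sub>R v3" (is "x = ?y")
proof -
  have "x - ?y = 0"
    by (rule orthogonal_to_orthogonal_triple[OF assms])
       (use assms in \<open>simp_all add: inner_diff_left inner_add_left inner_commute[of v2 v1]
         inner_commute[of v3 v1] inner_commute[of v3 v2]\<close>)
  then show ?thesis by simp
qed

section \<open>Indefinite cones are not contained in two planes\<close>

text \<open>
  A product of two linear forms that vanishes on the cone \<open>z\<^sub>1\<^sup>2 + z\<^sub>2\<^sup>2 = z\<^sub>3\<^sup>2\<close> vanishes at five of its
  points, which forces it to be a multiple \<open>s (z\<^sub>1\<^sup>2 + z\<^sub>2\<^sup>2 - z\<^sub>3\<^sup>2)\<close>.  A form of rank 3 does not split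
  over the reals, so \<open>s = 0\<close>.
\<close>

lemma two_planes_unit_circle_cone:
  fixes p1 p2 p3 q1 q2 q3 :: real
  assumes z: "\<And>z1 z2 z3. z1\<^sup>2 + z2\<^sup>2 = z3\<^sup>2 \<Longrightarrow>
      (p1 * z1 + p2 * z2 + p3 * z3) * (q1 * z1 + q2 * z2 + q3 * z3) = 0"
  shows "(p1 = 0 \<and> p2 = 0 \<and> p3 = 0) \<or> (q1 = 0 \<and> q2 = 0 \<and> q3 = 0)"
proof -
  have e: "(p1 + p3) * (q1 + q3) = 0" "(p3 - p1) * (q3 - q1) = 0"
    "(p2 + p3) * (q2 + q3) = 0" "(p3 - p2) * (q3 - q2) = 0"
    "(3 * p1 + 4 * p2 + 5 * p3) * (3 * q1 + 4 * q2 + 5 * q3) = 0"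
    using z[of 1 0 1] z[of "-1" 0 1] z[of 0 1 1] z[of 0 "-1" 1] z[of 3 4 5]
    by (simp_all add: algebra_simps)
  have f: "p1 * q1 = - (p3 * q3)" "p2 * q2 = - (p3 * q3)"
     "p1 * q3 = - (p3 * q1)" "p2 * q3 = - (p3 * q2)" "p1 * q2 = - (p2 * q1)"
    using e by (simp_all add: algebra_simps)
  \<comment> \<open>The common value \<open>p1 q1 = p2 q2\<close> has square \<open>(p1 q2) (p2 q1)\<close>, which is minus a square.\<close>
  have "(p3 * q3)\<^sup>2 = (p1 * q1) * (p2 * q2)" using f by (simp add: power2_eq_square)
  also have "\<dots> = (p1 * q2) * (p2 * q1)" by simp
  also have "\<dots> = - (p1 * q2)\<^sup>2" using f(5) by (simp add: power2_eq_square)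
  finally have "(p3 * q3)\<^sup>2 + (p1 * q2)\<^sup>2 = 0" by simp
  then have g: "p3 * q3 = 0" "p1 * q2 = 0" by (simp_all add: sum_power2_eq_zero_iff)
  then have h: "p1 * q1 = 0" "p2 * q2 = 0" "p2 * q1 = 0" using f by simp_all
  show ?thesis using f(3,4) g h by auto
qed

text \<open>Rescaling the coordinates by \<open>1 / sqrt \<bar>m\<^sub>i\<bar>\<close> reduces the cone to the standard one.\<close>

lemma two_planes_indefinite_diagonal:
  fixes m1 m2 m3 p1 p2 p3 q1 q2 q3 :: real
  assumes nz: "m1 \<noteq> 0" "m2 \<noteq> 0" "m3 \<noteq> 0"
    and s: "sgn m1 = sgn m2" "sgn m3 = - sgn m1"
    and y: "\<And>y1 y2 y3. m1 * y1\<^sup>2 + m2 * y2\<^sup>2 + m3 * y3\<^sup>2 = 0 \<Longrightarrow>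
      (p1 * y1 + p2 * y2 + p3 * y3) * (q1 * y1 + q2 * y2 + q3 * y3) = 0"
  shows "(p1 = 0 \<and> p2 = 0 \<and> p3 = 0) \<or> (q1 = 0 \<and> q2 = 0 \<and> q3 = 0)"
proof -
  define r where "r m = 1 / sqrt \<bar>m\<bar>" for m :: real
  have r: "m * (r m * t)\<^sup>2 = sgn m * t\<^sup>2" "r m \<noteq> 0" if "m \<noteq> 0" for m t
    using that by (auto simp: r_def power_mult_distrib power_divide sgn_real_def)
  have "(p1 * r m1 = 0 \<and> p2 * r m2 = 0 \<and> p3 * r m3 = 0) \<or>
        (q1 * r m1 = 0 \<and> q2 * r m2 = 0 \<and> q3 * r m3 = 0)"
  proof (rule two_planes_unit_circle_cone)
    fix z1 z2 z3 :: real
    assume "z1\<^sup>2 + z2\<^sup>2 = z3\<^sup>2"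
    then have "m1 * (r m1 * z1)\<^sup>2 + m2 * (r m2 * z2)\<^sup>2 + m3 * (r m3 * z3)\<^sup>2 = 0"
      using nz s by (simp add: r flip: distrib_left)
    from y[OF this]
    show "(p1 * r m1 * z1 + p2 * r m2 * z2 + p3 * r m3 * z3)
        * (q1 * r m1 * z1 + q2 * r m2 * z2 + q3 * r m3 * z3) = 0"
      by (simp add: mult.assoc)
  qed
  then show ?thesis using r(2) nz by simp
qed

lemma two_planes_indefinite_cone_ordered:
  fixes K :: "real^3^3"
  assumes nz: "v1 \<noteq> 0" "v2 \<noteq> 0" "v3 \<noteq> 0"
    and orth: "v1 \<bullet> v2 = 0" "v1 \<bullet> v3 = 0" "v2 \<bullet> v3 = 0"
    and K: "K *v v1 = m1 *\<^sub>R v1" "K *v v2 = m2 *\<^sub>R v2" "K *v v3 = m3 *\<^sub>R v3"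
    and m: "m1 \<noteq> 0" "m2 \<noteq> 0" "m3 \<noteq> 0" "sgn m1 = sgn m2" "sgn m3 = - sgn m1"
    and cone: "\<And>y. y \<bullet> (K *v y) = 0 \<Longrightarrow> (p \<bullet> y) * (q \<bullet> y) = 0"
  shows "p = 0 \<or> q = 0"
proof -
  define n1 n2 n3 where "n1 = v1 \<bullet> v1" and "n2 = v2 \<bullet> v2" and "n3 = v3 \<bullet> v3"
  have n: "n1 > 0" "n2 > 0" "n3 > 0" using nz by (simp_all add: n1_def n2_def n3_def)
  have "(p \<bullet> v1 = 0 \<and> p \<bullet> v2 = 0 \<and> p \<bullet> v3 = 0) \<or> (q \<bullet> v1 = 0 \<and> q \<bullet> v2 = 0 \<and> q \<bullet> v3 = 0)"
  proof (rule two_planes_indefinite_diagonal)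
    show "m1 * n1 \<noteq> 0" "m2 * n2 \<noteq> 0" "m3 * n3 \<noteq> 0" using m n by auto
    show "sgn (m1 * n1) = sgn (m2 * n2)" "sgn (m3 * n3) = - sgn (m1 * n1)"
      using m n by (simp_all add: sgn_mult)
    fix y1 y2 y3 :: real
    assume 0: "(m1 * n1) * y1\<^sup>2 + (m2 * n2) * y2\<^sup>2 + (m3 * n3) * y3\<^sup>2 = 0"
    let ?y = "y1 *\<^sub>R v1 + y2 *\<^sub>R v2 + y3 *\<^sub>R v3"
    have "?y \<bullet> (K *v ?y) = (m1 * n1) * y1\<^sup>2 + (m2 * n2) * y2\<^sup>2 + (m3 * n3) * y3\<^sup>2"
      using orth by (simp add: matrix_vector_right_distrib matrix_vector_mult_scaleR K
        inner_add_left inner_add_right inner_commute power2_eq_square n1_def n2_def n3_def)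
    with 0 have "?y \<bullet> (K *v ?y) = 0" by simp
    from cone[OF this]
    show "((p \<bullet> v1) * y1 + (p \<bullet> v2) * y2 + (p \<bullet> v3) * y3)
        * ((q \<bullet> v1) * y1 + (q \<bullet> v2) * y2 + (q \<bullet> v3) * y3) = 0"
      by (simp add: inner_add_right mult.commute)
  qed
  then show ?thesis
    using orthogonal_to_orthogonal_triple[OF nz orth] by blast
qed

lemma sgn_nonzero_cases: "m \<noteq> 0 \<Longrightarrow> sgn m = 1 \<or> sgn m = - 1" for m :: real
  by (simp add: sgn_real_def)

text \<open>
  Among three nonzero numbers that do not all have the same sign, two share a sign and the third has
  the opposite one; the three choices are permutations of the ordered case.
\<close>

lemma two_planes_indefinite_cone:
  fixes K :: "real^3^3"
  assumes nz: "v1 \<noteq> 0" "v2 \<noteq> 0" "v3 \<noteq> 0"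
    and orth: "v1 \<bullet> v2 = 0" "v1 \<bullet> v3 = 0" "v2 \<bullet> v3 = 0"
    and K: "K *v v1 = m1 *\<^sub>R v1" "K *v v2 = m2 *\<^sub>R v2" "K *v v3 = m3 *\<^sub>R v3"
    and m: "m1 \<noteq> 0" "m2 \<noteq> 0" "m3 \<noteq> 0" "\<not> (sgn m1 = sgn m2 \<and> sgn m2 = sgn m3)"
    and cone: "\<And>y. y \<bullet> (K *v y) = 0 \<Longrightarrow> (p \<bullet> y) * (q \<bullet> y) = 0"
  shows "p = 0 \<or> q = 0"
proof -
  have orth': "v2 \<bullet> v1 = 0" "v3 \<bullet> v1 = 0" "v3 \<bullet> v2 = 0"
    using orth by (simp_all add: inner_commute)
  consider "sgn m1 = sgn m2" "sgn m3 = - sgn m1" | "sgn m1 = sgn m3" "sgn m2 = - sgn m1"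
    | "sgn m2 = sgn m3" "sgn m1 = - sgn m2"
    using m(4) sgn_nonzero_cases[OF m(1)] sgn_nonzero_cases[OF m(2)] sgn_nonzero_cases[OF m(3)] by (metis minus_minus)
  then show ?thesis
  proof cases
    case 1
    show ?thesis
      by (rule two_planes_indefinite_cone_ordered[OF nz orth K m(1-3) 1 cone])
  next
    case 2
    show ?thesis
      by (rule two_planes_indefinite_cone_ordered[OF nz(1,3,2) orth(2,1) orth'(3) K(1,3,2)
            m(1,3,2) 2 cone])
  next
    case 3
    show ?thesis
      by (rule two_planes_indefinite_cone_ordered[OF nz(2,3,1) orth(3) orth'(1,2) K(2,3,1)
            m(2,3,1) 3 cone])
  qed
qed

section \<open>Reflections that preserve a quadratic cone\<close>

text \<open>The linear part of \<open>plane_reflection n d\<close> is \<open>plane_reflection n 0\<close>.\<close>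

lemma plane_reflection_decompose:
  "plane_reflection n d (u + y)
     = u + plane_reflection n 0 y - (2 * (u \<bullet> n - d) / (n \<bullet> n)) *\<^sub>R n"
proof -
  have "2 * ((u + y) \<bullet> n - d) / (n \<bullet> n) = 2 * (y \<bullet> n - 0) / (n \<bullet> n) + 2 * (u \<bullet> n - d) / (n \<bullet> n)"
    by (simp add: inner_add_left flip: add_divide_distrib)
  then show ?thesis
    by (simp only: plane_reflection_def scaleR_add_left) simp
qed

lemma plane_reflection_fixes_point:
  "plane_reflection n (u \<bullet> n) (u + y) = u + plane_reflection n 0 y"
  using plane_reflection_decompose[of n "u \<bullet> n" u y] by simp

lemma plane_reflection_0_scaleR: "plane_reflection n 0 (t *\<^sub>R y) = t *\<^sub>R plane_reflection n 0 y"
  unfolding plane_reflection_def by (simp add: scaleR_diff_right mult.left_commute[of t])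

lemma plane_reflection_involutive:
  assumes n: "n \<noteq> 0"
  shows "plane_reflection n d (plane_reflection n d x) = x"
proof -
  define t where "t = 2 * (x \<bullet> n - d) / (n \<bullet> n)"
  have R: "plane_reflection n d x = x - t *\<^sub>R n" by (simp add: plane_reflection_def t_def)
  have "2 * ((x - t *\<^sub>R n) \<bullet> n - d) / (n \<bullet> n) = - t"
    using n by (simp add: t_def inner_diff_left field_simps)
  then have "plane_reflection n d (x - t *\<^sub>R n) = x"
    by (simp only: plane_reflection_def) simp
  then show ?thesis by (simp only: R)
qed

lemma plane_reflection_0_adjoint: "x \<bullet> plane_reflection n 0 y = plane_reflection n 0 x \<bullet> y"
  by (simp add: plane_reflection_def inner_diff_left inner_diff_right inner_commute[of n y])

text \<open>
  Reflection changes the quadratic form by a product of two linear forms, the second one given by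
  the component of \<open>K n\<close> orthogonal to \<open>n\<close>.  The change vanishes when \<open>n\<close> is an eigenvector; conversely, it
  must vanish on the cone if the cone is to be preserved.
\<close>

lemma quadratic_form_reflection:
  assumes sym: "transpose K = K" and n: "n \<noteq> 0"
  shows "plane_reflection n 0 y \<bullet> (K *v plane_reflection n 0 y) = y \<bullet> (K *v y)
     - 4 / (n \<bullet> n) * ((n \<bullet> y) * ((K *v n - (n \<bullet> (K *v n) / (n \<bullet> n)) *\<^sub>R n) \<bullet> y))"
proof -
  have c: "n \<bullet> (K *v y) = y \<bullet> (K *v n)"
    using sym_matrix_inner[OF sym, of n y] by (simp add: inner_commute)
  have N: "n \<bullet> n \<noteq> 0" using n by simp
  define t where "t = 2 * (y \<bullet> n) / (n \<bullet> n)"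
  have R: "plane_reflection n 0 y = y - t *\<^sub>R n" by (simp add: plane_reflection_def t_def)
  have Q: "(y - t *\<^sub>R n) \<bullet> (K *v (y - t *\<^sub>R n))
     = y \<bullet> (K *v y) - 2 * t * (y \<bullet> (K *v n)) + t * t * (n \<bullet> (K *v n))"
    by (simp add: matrix_vector_mult_diff_distrib matrix_vector_mult_scaleR inner_diff_left
        inner_diff_right c algebra_simps)
  show ?thesis
    unfolding R Q using N by (simp add: t_def inner_diff_right inner_commute[of _ y] field_simps)
qed

lemma eigenvector_symmetry_plane:
  fixes K :: "real^3^3"
  assumes sym: "transpose K = K" and n: "n \<noteq> 0" "K *v n = m *\<^sub>R n"
  shows "symmetry_plane {x. x \<bullet> n = u \<bullet> n} (quadratic_cone K u)"
proof -
  let ?R = "plane_reflection n (u \<bullet> n)" and ?S = "quadratic_cone K u"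
  have into: "?R x \<in> ?S" if "x \<in> ?S" for x
  proof -
    have "?R x - u = plane_reflection n 0 (x - u)"
      using plane_reflection_fixes_point[of n u "x - u"] by simp
    then show ?thesis
      using that n(1) by (simp add: quadratic_cone_def quadratic_form_reflection[OF sym] n(2))
  qed
  have "?R ` ?S = ?S"
  proof
    show "?S \<subseteq> ?R ` ?S"
      by (metis image_eqI into n(1) plane_reflection_involutive subsetI)
  qed (use into in blast)
  then show ?thesis using n(1) by (auto simp: symmetry_plane_def)
qed

text \<open>
  Let \<open>e\<close> be the displacement of the apex.  For \<open>y\<close> on the cone the whole reflected line through \<open>u\<close>
  in direction \<open>y\<close> lies on the cone, so a quadratic polynomial in the line parameter vanishes
  identically.  Its linear coefficient says that \<open>y\<close> is orthogonal to the reflected \<open>K e\<close>, which would put the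
  cone into a plane unless \<open>K e = 0\<close>.
\<close>

lemma reflection_of_cone_fixes_apex:
  fixes K :: "real^3^3"
  assumes sym: "transpose K = K" and inj: "\<And>x. K *v x = 0 \<Longrightarrow> x = 0"
    and planes: "\<And>p q. (\<And>y. y \<bullet> (K *v y) = 0 \<Longrightarrow> (p \<bullet> y) * (q \<bullet> y) = 0) \<Longrightarrow> p = 0 \<or> q = 0"
    and n: "n \<noteq> 0"
    and R: "plane_reflection n d ` quadratic_cone K u \<subseteq> quadratic_cone K u"
  shows "d = u \<bullet> n"
proof -
  define e where "e = (2 * (u \<bullet> n - d) / (n \<bullet> n)) *\<^sub>R n"
  have "plane_reflection n 0 (K *v e) \<bullet> y = 0" if y: "y \<bullet> (K *v y) = 0" for y
  proof -
    let ?z = "plane_reflection n 0 y"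
    have "t * t * (?z \<bullet> (K *v ?z)) - 2 * t * ((K *v e) \<bullet> ?z) + e \<bullet> (K *v e) = 0" for t
    proof -
      have "u + t *\<^sub>R y \<in> quadratic_cone K u"
        using y by (simp add: quadratic_cone_def matrix_vector_mult_scaleR)
      then have "plane_reflection n d (u + t *\<^sub>R y) \<in> quadratic_cone K u" using R by blast
      then have "(t *\<^sub>R ?z - e) \<bullet> (K *v (t *\<^sub>R ?z - e)) = 0"
        by (simp add: quadratic_cone_def plane_reflection_decompose plane_reflection_0_scaleR e_def)
      then show ?thesis
        by (simp add: matrix_vector_mult_diff_distrib matrix_vector_mult_scaleR inner_diff_left
            inner_diff_right sym_matrix_inner[OF sym, of e ?z] inner_commute[of ?z "K *v e"] algebra_simps)
    qed
    \<comment> \<open>The values at \<open>1\<close> and \<open>- 1\<close> differ by twice the linear coefficient.\<close>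
    from this[of 1] this[of "-1"] have "(K *v e) \<bullet> ?z = 0" by simp
    then show ?thesis by (simp add: plane_reflection_0_adjoint)
  qed
  then have "plane_reflection n 0 (K *v e) = 0"
    using planes[of "plane_reflection n 0 (K *v e)" "plane_reflection n 0 (K *v e)"] by simp
  then have "K *v e = plane_reflection n 0 0"
    using plane_reflection_involutive[OF n] by metis
  then have "K *v e = 0" by (simp add: plane_reflection_def)
  then have "e = 0" by (rule inj)
  then show ?thesis using n by (simp add: e_def)
qed

lemma reflection_of_cone_normal_eigenvector:
  fixes K :: "real^3^3"
  assumes sym: "transpose K = K"
    and planes: "\<And>p q. (\<And>y. y \<bullet> (K *v y) = 0 \<Longrightarrow> (p \<bullet> y) * (q \<bullet> y) = 0) \<Longrightarrow> p = 0 \<or> q = 0"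
    and n: "n \<noteq> 0"
    and R: "plane_reflection n (u \<bullet> n) ` quadratic_cone K u \<subseteq> quadratic_cone K u"
  shows "K *v n = (n \<bullet> (K *v n) / (n \<bullet> n)) *\<^sub>R n"
proof -
  let ?m = "K *v n - (n \<bullet> (K *v n) / (n \<bullet> n)) *\<^sub>R n"
  have "(n \<bullet> y) * (?m \<bullet> y) = 0" if y: "y \<bullet> (K *v y) = 0" for y
  proof -
    have "u + y \<in> quadratic_cone K u" using y by (simp add: quadratic_cone_def)
    then have "plane_reflection n (u \<bullet> n) (u + y) \<in> quadratic_cone K u" using R by blast
    then have "plane_reflection n 0 y \<bullet> (K *v plane_reflection n 0 y) = 0"
      by (simp add: quadratic_cone_def plane_reflection_fixes_point)
    then have "4 / (n \<bullet> n) * ((n \<bullet> y) * (?m \<bullet> y)) = 0"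
      using y by (simp only: quadratic_form_reflection[OF sym n])
    then show ?thesis using n by auto
  qed
  then have "n = 0 \<or> ?m = 0" by (rule planes)
  then show ?thesis using n by simp
qed

text \<open>
  Symmetry of \<open>K\<close> makes \<open>n\<close> orthogonal to each \<open>v\<^sub>i\<close> with \<open>m\<^sub>i \<noteq> m\<close>, and at most one \<open>m\<^sub>i\<close> equals \<open>m\<close>.
\<close>

lemma eigenvector_parallel_orthogonal_triple:
  fixes K :: "real^3^3"
  assumes sym: "transpose K = K"
    and nz: "v1 \<noteq> 0" "v2 \<noteq> 0" "v3 \<noteq> 0"
    and orth: "v1 \<bullet> v2 = 0" "v1 \<bullet> v3 = 0" "v2 \<bullet> v3 = 0"
    and K: "K *v v1 = m1 *\<^sub>R v1" "K *v v2 = m2 *\<^sub>R v2" "K *v v3 = m3 *\<^sub>R v3"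
    and d: "m1 \<noteq> m2" "m1 \<noteq> m3" "m2 \<noteq> m3"
    and n: "K *v n = m *\<^sub>R n"
  shows "\<exists>v\<in>{v1, v2, v3}. \<exists>s. n = s *\<^sub>R v"
proof -
  have "m * (n \<bullet> v) = k * (n \<bullet> v)" if "K *v v = k *\<^sub>R v" for v k
    using sym_matrix_inner[OF sym, of n v] by (auto simp: n that)
  then have *: "n \<bullet> v1 = 0 \<or> m = m1" "n \<bullet> v2 = 0 \<or> m = m2" "n \<bullet> v3 = 0 \<or> m = m3"
    using K by fastforce+
  define c where "c v = n \<bullet> v / (v \<bullet> v)" for v
  have e: "n = c v1 *\<^sub>R v1 + c v2 *\<^sub>R v2 + c v3 *\<^sub>R v3"
    unfolding c_def by (rule orthogonal_triple_expansion[OF nz orth])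
  have "c v1 = 0 \<and> c v2 = 0 \<or> c v1 = 0 \<and> c v3 = 0 \<or> c v2 = 0 \<and> c v3 = 0"
    using * d unfolding c_def by (metis div_0)
  then have "n = c v3 *\<^sub>R v3 \<or> n = c v2 *\<^sub>R v2 \<or> n = c v1 *\<^sub>R v1"
  proof (elim disjE conjE)
    assume "c v1 = 0" "c v2 = 0" then show ?thesis by (subst (1) e) simp
  next
    assume "c v1 = 0" "c v3 = 0" then show ?thesis by (subst (2) e) simp
  next
    assume "c v2 = 0" "c v3 = 0" then show ?thesis by (subst (3) e) simp
  qed
  then show ?thesis by blast
qed

lemma symmetry_planes_of_cone:
  fixes K :: "real^3^3"
  assumes sym: "transpose K = K"
    and nz: "v1 \<noteq> 0" "v2 \<noteq> 0" "v3 \<noteq> 0"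
    and orth: "v1 \<bullet> v2 = 0" "v1 \<bullet> v3 = 0" "v2 \<bullet> v3 = 0"
    and K: "K *v v1 = m1 *\<^sub>R v1" "K *v v2 = m2 *\<^sub>R v2" "K *v v3 = m3 *\<^sub>R v3"
    and m: "m1 \<noteq> 0" "m2 \<noteq> 0" "m3 \<noteq> 0" "\<not> (sgn m1 = sgn m2 \<and> sgn m2 = sgn m3)"
    and d: "m1 \<noteq> m2" "m1 \<noteq> m3" "m2 \<noteq> m3"
  shows "{P. symmetry_plane P (quadratic_cone K u)} = (\<lambda>v. {x. x \<bullet> v = u \<bullet> v}) ` {v1, v2, v3}"
proof (intro equalityI subsetI)
  fix P
  assume "P \<in> {P. symmetry_plane P (quadratic_cone K u)}"
  then obtain n d where n: "n \<noteq> 0" and P: "P = {x. x \<bullet> n = d}"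
    and R: "plane_reflection n d ` quadratic_cone K u \<subseteq> quadratic_cone K u"
    unfolding symmetry_plane_def mem_Collect_eq by (metis subset_refl)
  have planes: "p = 0 \<or> q = 0" if "\<And>y. y \<bullet> (K *v y) = 0 \<Longrightarrow> (p \<bullet> y) * (q \<bullet> y) = 0" for p q
    by (rule two_planes_indefinite_cone[OF nz orth K m that])
  have inj: "x = 0" if "K *v x = 0" for x
  proof -
    have "x \<bullet> v = 0" if "K *v v = k *\<^sub>R v" "k \<noteq> 0" for v k
      using sym_matrix_inner[OF sym, of x v] \<open>K *v x = 0\<close> that by simp
    then show ?thesis
      using orthogonal_to_orthogonal_triple[OF nz orth, of x] K m by blast
  qed
  have du: "d = u \<bullet> n"
    by (rule reflection_of_cone_fixes_apex[OF sym _ _ n R]) (fact inj, fact planes)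
  have "K *v n = (n \<bullet> (K *v n) / (n \<bullet> n)) *\<^sub>R n"
    by (rule reflection_of_cone_normal_eigenvector[OF sym _ n R[unfolded du]]) (fact planes)
  then obtain s v where v: "v \<in> {v1, v2, v3}" "n = s *\<^sub>R v"
    using eigenvector_parallel_orthogonal_triple[OF sym nz orth K d] by meson
  then have "P = {x. x \<bullet> v = u \<bullet> v}" using n by (simp add: P du)
  then show "P \<in> (\<lambda>v. {x. x \<bullet> v = u \<bullet> v}) ` {v1, v2, v3}" using v(1) by blast
next
  fix P
  assume "P \<in> (\<lambda>v. {x. x \<bullet> v = u \<bullet> v}) ` {v1, v2, v3}"
  then show "P \<in> {P. symmetry_plane P (quadratic_cone K u)}"
    using eigenvector_symmetry_plane[OF sym] nz K by blast
qed

section \<open>Circular cones\<close>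

lemma columnvector_rowvector_mult:
  "((columnvector u :: real^1^'n) ** rowvector v) *v x = (v \<bullet> x) *\<^sub>R u"
  by (simp add: vec_eq_iff matrix_vector_mult_def matrix_matrix_mult_def columnvector_def
      rowvector_def inner_vec_def sum_distrib_left sum_distrib_right mult_ac)

text \<open>
  Every vector orthogonal to the axis \<open>r\<close> is an eigenvector of \<open>r r\<^sup>T - cos\<^sup>2 \<theta> I\<close>, so each plane that contains the
  axis is a plane of symmetry, whatever the opening angle.
\<close>

lemma circular_cone_symmetry_planes:
  assumes "circular_cone S"
  shows "infinite {P. symmetry_plane P S}"
proof -
  obtain u r \<theta> where r: "norm r = 1"
    and S: "S = quadratic_cone ((columnvector r :: real^1^3) ** rowvector r - (cos \<theta>)\<^sup>2 *\<^sub>R mat 1) u"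
    using assms by (auto simp: circular_cone_def)
  let ?M = "(columnvector r :: real^1^3) ** rowvector r - (cos \<theta>)\<^sup>2 *\<^sub>R mat 1"
  have sym: "transpose ?M = ?M"
    by (simp add: vec_eq_iff transpose_def matrix_matrix_mult_def columnvector_def rowvector_def mat_def)
  obtain p where p: "p \<noteq> 0" "r \<bullet> p = 0"
    using orthogonal_to_vector_exists[of r] by (auto simp: orthogonal_def)
  define q where "q = cross3 r p"
  have q: "r \<bullet> q = 0" "p \<bullet> q = 0" "q \<bullet> q = p \<bullet> p"
    using p(2) r norm_cross_dot[of r p]
    by (auto simp: q_def dot_cross_self dot_cross norm_eq_1)
  define P where "P t = {x. x \<bullet> (p + t *\<^sub>R q) = u \<bullet> (p + t *\<^sub>R q)}" for t
  have "symmetry_plane (P t) S" for t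
    unfolding P_def S
  proof (rule eigenvector_symmetry_plane[OF sym])
    have "(p + t *\<^sub>R q) \<bullet> p = p \<bullet> p" using q by (simp add: inner_add_left inner_commute[of q p])
    then show "p + t *\<^sub>R q \<noteq> 0" using p by auto
    show "?M *v (p + t *\<^sub>R q) = (- (cos \<theta>)\<^sup>2) *\<^sub>R (p + t *\<^sub>R q)"
      using p q by (simp add: matrix_vector_mult_diff_rdistrib columnvector_rowvector_mult
          inner_add_right flip: scaleR_matrix_vector_assoc)
  qed
  then have sub: "range P \<subseteq> {P. symmetry_plane P S}" by blast
  have "inj P"
  proof (rule injI)
    fix s t
    assume st: "P s = P t"
    \<comment> \<open>Among the normals \<open>p + t q\<close>, the vector \<open>s p - q\<close> is orthogonal only to the one with \<open>t = s\<close>.\<close>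
    have "(s *\<^sub>R p - q) \<bullet> (p + s *\<^sub>R q) = 0"
      using q by (simp add: inner_add_right inner_diff_left inner_commute[of q p])
    then have "u + (s *\<^sub>R p - q) \<in> P s" by (simp add: P_def inner_add_left)
    then have "u + (s *\<^sub>R p - q) \<in> P t" by (simp only: st)
    then have "(s *\<^sub>R p - q) \<bullet> (p + t *\<^sub>R q) = 0" by (simp add: P_def inner_add_left)
    then show "s = t"
      using p q by (simp add: inner_add_right inner_diff_left inner_commute[of q p])
  qed
  then have "infinite (range P)"
    using infinite_UNIV_char_0 by (simp add: finite_image_iff)
  with sub show ?thesis by (rule infinite_super)
qed

section \<open>Tangent cones and tangent planes\<close>

lemma tangent_cone_matrix_vector:
  assumes "transpose A = A"
  shows "tangent_cone_matrix A u *v h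
    = (h \<bullet> (A *v u)) *\<^sub>R (A *v u) + (1 - u \<bullet> (A *v u)) *\<^sub>R (A *v h)"
proof -
  have "A ** (columnvector u :: real^1^'a) ** rowvector u ** A *v h
      = A *v (((columnvector u :: real^1^'a) ** rowvector u) *v (A *v h))"
    by (simp add: matrix_vector_mul_assoc matrix_mul_assoc)
  then show ?thesis
    by (simp add: tangent_cone_matrix_def matrix_vector_mult_add_rdistrib
        columnvector_rowvector_mult matrix_vector_mult_scaleR sym_matrix_inner[OF assms, of u h] inner_commute
        flip: scaleR_matrix_vector_assoc)
qed

lemma transpose_tangent_cone_matrix:
  assumes "transpose A = A"
  shows "transpose (tangent_cone_matrix A u) = tangent_cone_matrix A u"
proof -
  have "transpose (A ** (columnvector u :: real^1^'a) ** rowvector u ** A)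
     = A ** (columnvector u :: real^1^'a) ** rowvector u ** A"
    by (simp add: matrix_transpose_mul assms transpose_columnvector transpose_rowvector matrix_mul_assoc)
  then show ?thesis
    using assms by (simp add: tangent_cone_matrix_def vec_eq_iff transpose_def)
qed

text \<open>
  With \<open>h = x - u\<close> the line is \<open>u + t h\<close>, and the discriminant of its equation is \<open>4 h\<^sup>T K h\<close>.  The coefficients
  of a polynomial function are determined by its values, which disposes of the existential quantifier
  in the definition of the tangent cone.
\<close>

lemma tangent_cone_eq_quadratic_cone:
  assumes sym: "transpose A = A"
  shows "tangent_cone A u = quadratic_cone (tangent_cone_matrix A u) u"
proof (intro set_eqI)
  fix x
  define h where "h = x - u"
  define P Q R where "P = h \<bullet> (A *v h)" and "Q = 2 * (h \<bullet> (A *v u))" and "R = u \<bullet> (A *v u) - 1"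
  have expand: "(t *\<^sub>R x + (1 - t) *\<^sub>R u) \<bullet> (A *v (t *\<^sub>R x + (1 - t) *\<^sub>R u)) - 1
      = P * t\<^sup>2 + Q * t + R" for t
  proof -
    have "t *\<^sub>R x + (1 - t) *\<^sub>R u = u + t *\<^sub>R h" by (simp add: h_def algebra_simps)
    then show ?thesis
      by (simp add: matrix_vector_right_distrib matrix_vector_mult_scaleR inner_add_left
          inner_add_right P_def Q_def R_def power2_eq_square
          sym_matrix_inner[OF sym, of u h] inner_commute algebra_simps)
  qed
  have coeffs: "p = P \<and> q = Q \<and> r = R" if "\<And>t. P * t\<^sup>2 + Q * t + R = p * t\<^sup>2 + q * t + r" for p q r
    using that[of 0] that[of 1] that[of "-1"] by simp
  have "x \<in> tangent_cone A u \<longleftrightarrow> discrim P Q R = 0"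
    unfolding tangent_cone_def mem_Collect_eq expand using coeffs by blast
  also have "\<dots> \<longleftrightarrow> x \<in> quadratic_cone (tangent_cone_matrix A u) u"
    by (simp add: quadratic_cone_def tangent_cone_matrix_vector[OF sym] discrim_def
        inner_add_right power2_eq_square P_def Q_def R_def flip: h_def) (simp add: algebra_simps)
  finally show "x \<in> tangent_cone A u \<longleftrightarrow> x \<in> quadratic_cone (tangent_cone_matrix A u) u" .
qed

lemma tangent_plane_quadratic_form:
  assumes sym: "transpose A = A"
  shows "tangent_plane (\<lambda>x. x \<bullet> (A *v x)) u = {x. x \<bullet> (A *v u) = u \<bullet> (A *v u)}"
proof -
  have "((\<lambda>x. x \<bullet> (A *v x)) has_derivative (\<lambda>h. u \<bullet> (A *v h) + h \<bullet> (A *v u))) (at u)"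
    by (intro has_derivative_inner has_derivative_ident
        bounded_linear_imp_has_derivative matrix_vector_mul_bounded_linear)
  then have "frechet_derivative (\<lambda>x. x \<bullet> (A *v x)) (at u) = (\<lambda>h. u \<bullet> (A *v h) + h \<bullet> (A *v u))"
    by (rule frechet_derivative_at[symmetric])
  also have "\<dots> = (\<lambda>h. 2 * (h \<bullet> (A *v u)))"
  proof
    fix h
    show "u \<bullet> (A *v h) + h \<bullet> (A *v u) = 2 * (h \<bullet> (A *v u))"
      using sym_matrix_inner[OF sym, of u h] inner_commute[of "A *v u" h] by linarith
  qed
  finally show ?thesis by (simp add: tangent_plane_def inner_diff_left)
qed

section \<open>The confocal family\<close>

lemma transpose_confocal_matrix: "transpose (confocal_matrix a b c k) = confocal_matrix a b c k"
  by (auto simp: vec_eq_iff transpose_def confocal_matrix_def)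

lemma confocal_matrix_vector:
  "confocal_matrix a b c k *v x = vector [x $ 1 / (a - k), x $ 2 / (b - k), x $ 3 / (c - k)]"
  by (simp add: vec_eq_iff forall_3 matrix_vector_mult_def sum_3 confocal_matrix_def)

lemma confocal_quadratic_form:
  "x \<bullet> (confocal_matrix a b c k *v x) = (x $ 1)\<^sup>2 / (a - k) + (x $ 2)\<^sup>2 / (b - k) + (x $ 3)\<^sup>2 / (c - k)"
  by (simp add: confocal_matrix_vector inner_vec_def sum_3 power2_eq_square)

lemma inverse_difference_scaled:
  fixes x d e :: real
  assumes "d \<noteq> 0" "e \<noteq> 0"
  shows "(d - e) * (x / (d * e)) = x / e - x / d"
  using assms by (simp add: field_simps)

text \<open>The resolvent identity of the diagonal matrix with entries \<open>a, b, c\<close>.\<close>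

lemma confocal_resolvent:
  assumes "k \<notin> {a, b, c}" "l \<notin> {a, b, c}"
  shows "(l - k) *\<^sub>R (confocal_matrix a b c l *v (confocal_matrix a b c k *v x))
     = confocal_matrix a b c l *v x - confocal_matrix a b c k *v x"
proof -
  have "(l - k) * (y / ((e - k) * (e - l))) = y / (e - l) - y / (e - k)" if "e \<in> {a, b, c}" for y e
    using inverse_difference_scaled[of "e - k" "e - l" y] assms that by auto
  then show ?thesis by (simp add: vec_eq_iff forall_3 confocal_matrix_vector)
qed

text \<open>
  Put \<open>v = A\<^sub>k u\<close> and \<open>s = u\<^sup>T A\<^sub>l u\<close>.  The resolvent identity and \<open>u\<^sup>T v = 1\<close> give \<open>A\<^sub>l v = (A\<^sub>l u - v) / (l - k)\<close> and
  \<open>v\<^sup>T A\<^sub>l u = (s - 1) / (l - k)\<close>.  In \<open>K v = (v\<^sup>T A\<^sub>l u) A\<^sub>l u + (1 - s) A\<^sub>l v\<close> the multiples of \<open>A\<^sub>l u\<close> then cancel.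
\<close>

lemma tangent_cone_matrix_confocal_eigenvector:
  assumes k: "k \<notin> {a, b, c}" and l: "l \<notin> {a, b, c}" "l \<noteq> k"
    and u: "u \<in> quadric (confocal_matrix a b c k)"
  shows "tangent_cone_matrix (confocal_matrix a b c l) u *v (confocal_matrix a b c k *v u)
    = ((u \<bullet> (confocal_matrix a b c l *v u) - 1) / (l - k)) *\<^sub>R (confocal_matrix a b c k *v u)"
proof -
  let ?A = "confocal_matrix a b c"
  let ?s = "u \<bullet> (?A l *v u)"
  have uk: "u \<bullet> (?A k *v u) = 1" using u by (simp add: quadric_def)
  have AA: "?A l *v (?A k *v u) = (1 / (l - k)) *\<^sub>R (?A l *v u - ?A k *v u)"
    using confocal_resolvent[OF k l(1), of u] l(2)
    by (metis eq_iff_diff_eq_0 vector_fraction_eq_iff scaleR_one)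
  have "(?A k *v u) \<bullet> (?A l *v u) = u \<bullet> (?A l *v (?A k *v u))"
    by (metis sym_matrix_inner[OF transpose_confocal_matrix] inner_commute)
  also have "\<dots> = (?s - 1) / (l - k)"
    by (simp add: AA inner_diff_right uk diff_divide_distrib)
  finally show ?thesis
    by (simp add: tangent_cone_matrix_vector[OF transpose_confocal_matrix] AA)
       (simp add: algebra_simps diff_divide_distrib)
qed

lemma quadratic_three_roots:
  fixes p q r :: real
  assumes "x \<noteq> y" "x \<noteq> z" "y \<noteq> z"
    and "p * x\<^sup>2 + q * x + r = 0" "p * y\<^sup>2 + q * y + r = 0" "p * z\<^sup>2 + q * z + r = 0"
  shows "p = 0 \<and> q = 0 \<and> r = 0"
proof -
  have "(x - y) * (p * (x + y) + q) = 0" "(x - z) * (p * (x + z) + q) = 0"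
    using assms(4-6) by (simp_all add: algebra_simps power2_eq_square)
  then have 1: "p * (x + y) + q = 0" "p * (x + z) + q = 0" using assms by simp_all
  then have "p * (x + y) = p * (x + z)" by linarith
  then have "p * (y - z) = 0" by (simp add: right_diff_distrib distrib_left)
  then have "p = 0" using assms by simp
  with 1 assms(4) show ?thesis by simp
qed

text \<open>
  Multiplied by \<open>(a - l) (b - l) (c - l)\<close>, the left-hand side becomes a monic cubic in \<open>l\<close> that vanishes at the three
  \<open>k\<^sub>i\<close>.  Its difference from \<open>(l - k\<^sub>1) (l - k\<^sub>2) (l - k\<^sub>3)\<close> is a quadratic with three roots, hence zero.
\<close>

lemma confocal_quadratic_form_factored:
  assumes k: "k1 \<notin> {a, b, c}" "k2 \<notin> {a, b, c}" "k3 \<notin> {a, b, c}"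
    and d: "k1 \<noteq> k2" "k1 \<noteq> k3" "k2 \<noteq> k3" and l: "l \<notin> {a, b, c}"
    and u: "u \<in> quadric (confocal_matrix a b c k1)" "u \<in> quadric (confocal_matrix a b c k2)"
      "u \<in> quadric (confocal_matrix a b c k3)"
  shows "u \<bullet> (confocal_matrix a b c l *v u) - 1
    = (l - k1) * (l - k2) * (l - k3) / ((a - l) * (b - l) * (c - l))"
proof -
  define X Y Z where "X = (u $ 1)\<^sup>2" and "Y = (u $ 2)\<^sup>2" and "Z = (u $ 3)\<^sup>2"
  define f where "f k = X * (b - k) * (c - k) + Y * (a - k) * (c - k) + Z * (a - k) * (b - k)
    - (a - k) * (b - k) * (c - k) - (k - k1) * (k - k2) * (k - k3)" for k
  define p q r where "p = X + Y + Z - a - b - c + k1 + k2 + k3"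
    and "q = a * b + a * c + b * c - X * (b + c) - Y * (a + c) - Z * (a + b) - k1 * k2 - k1 * k3 - k2 * k3"
    and "r = X * b * c + Y * a * c + Z * a * b - a * b * c + k1 * k2 * k3"
  have f: "f k = p * k\<^sup>2 + q * k + r" for k
    by (simp add: f_def p_def q_def r_def algebra_simps power2_eq_square)
  have form: "X * (b - k) * (c - k) + Y * (a - k) * (c - k) + Z * (a - k) * (b - k)
    - (a - k) * (b - k) * (c - k)
    = (u \<bullet> (confocal_matrix a b c k *v u) - 1) * ((a - k) * (b - k) * (c - k))"
    if "k \<notin> {a, b, c}" for k
  proof -
    have "P * B * C + Q * A * C + R * A * B - A * B * C = (P / A + Q / B + R / C - 1) * (A * B * C)"
      if "A \<noteq> 0" "B \<noteq> 0" "C \<noteq> 0" for A B C P Q R :: real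
      using that by (simp add: field_simps)
    then show ?thesis using that by (simp add: confocal_quadratic_form X_def Y_def Z_def)
  qed
  have "f k1 = 0" "f k2 = 0" "f k3 = 0"
    using form[OF k(1)] form[OF k(2)] form[OF k(3)] u by (simp_all add: f_def quadric_def)
  then have "p * k1\<^sup>2 + q * k1 + r = 0" "p * k2\<^sup>2 + q * k2 + r = 0" "p * k3\<^sup>2 + q * k3 + r = 0"
    by (simp_all only: f)
  then have "p = 0 \<and> q = 0 \<and> r = 0" by (rule quadratic_three_roots[OF d])
  then have "f l = 0" by (simp add: f)
  then have "(u \<bullet> (confocal_matrix a b c l *v u) - 1) * ((a - l) * (b - l) * (c - l))
     = (l - k1) * (l - k2) * (l - k3)"
    using form[OF l] by (simp add: f_def)
  moreover have "(a - l) * (b - l) * (c - l) \<noteq> 0" using l by auto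
  ultimately show ?thesis by (rule nonzero_eq_divide_eq[THEN iffD2, rotated])
qed

text \<open>
  Apply \<open>u\<^sup>T\<close> to the resolvent identity: the right-hand side becomes \<open>1 - 1\<close>.
\<close>

lemma confocal_normals_orthogonal:
  assumes "k \<notin> {a, b, c}" "l \<notin> {a, b, c}" "l \<noteq> k"
    and "u \<in> quadric (confocal_matrix a b c k)" "u \<in> quadric (confocal_matrix a b c l)"
  shows "(confocal_matrix a b c k *v u) \<bullet> (confocal_matrix a b c l *v u) = 0"
proof -
  let ?A = "confocal_matrix a b c"
  have "(l - k) * (u \<bullet> (?A l *v (?A k *v u))) = 0"
    using confocal_resolvent[OF assms(1,2), of u, THEN arg_cong, of "inner u"] assms(4,5)
    by (simp add: inner_diff_right quadric_def)
  then show ?thesis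
    using assms(3) sym_matrix_inner[OF transpose_confocal_matrix, of u] by (simp add: inner_commute)
qed

section \<open>Axes and planes of symmetry of the tangent cone\<close>

theorem mainTheorem2:
  fixes a b c k1 k2 k3 l :: real and u :: "real^3"
  defines "A \<equiv> confocal_matrix a b c"
  defines "K \<equiv> tangent_cone_matrix (A l) u"
  defines "ev1 \<equiv> (l - k2) * (l - k3) / ((a - l) * (b - l) * (c - l))"
  defines "ev2 \<equiv> (l - k1) * (l - k3) / ((a - l) * (b - l) * (c - l))"
  defines "ev3 \<equiv> (l - k1) * (l - k2) / ((a - l) * (b - l) * (c - l))"
  assumes "c < b" and "b < a"
    and "u $ 1 \<noteq> 0" and "u $ 2 \<noteq> 0" and "u $ 3 \<noteq> 0"
    and "k1 < c" and "c < k2" and "k2 < b" and "b < k3" and "k3 < a"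
    and "u \<in> quadric (A k1)" and "u \<in> quadric (A k2)" and "u \<in> quadric (A k3)"
    and "l \<notin> {a, b, c, k1, k2, k3}"
  shows "tangent_cone (A l) u = quadratic_cone K u
    \<and> eigenvector_of K (A k1 *v u) ev1
    \<and> eigenvector_of K (A k2 *v u) ev2
    \<and> eigenvector_of K (A k3 *v u) ev3
    \<and> ev1 \<noteq> 0 \<and> ev2 \<noteq> 0 \<and> ev3 \<noteq> 0
    \<and> distinct [ev1, ev2, ev3]
    \<and> (\<not> (sgn ev1 = sgn ev2 \<and> sgn ev2 = sgn ev3) \<longleftrightarrow> k1 < l \<and> l < k3)
    \<and> (\<forall>k\<in>{k1, k2, k3}.
         tangent_plane (\<lambda>x. x \<bullet> (A k *v x)) u = {x. x \<bullet> (A k *v u) = 1})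
    \<and> (\<not> (sgn ev1 = sgn ev2 \<and> sgn ev2 = sgn ev3) \<longrightarrow>
         real_cone u (quadratic_cone K u)
         \<and> \<not> circular_cone (quadratic_cone K u)
         \<and> {P. symmetry_plane P (quadratic_cone K u)}
             = {{x. x \<bullet> (A k1 *v u) = 1}, {x. x \<bullet> (A k2 *v u) = 1}, {x. x \<bullet> (A k3 *v u) = 1}})"
proof -
  define D where "D = (a - l) * (b - l) * (c - l)"
  define s where "s = u \<bullet> (A l *v u)"
  let ?v = "\<lambda>k. A k *v u"
  let ?S = "quadratic_cone K u"
  have l: "l \<notin> {a, b, c}" "l \<noteq> k1" "l \<noteq> k2" "l \<noteq> k3" using assms by auto
  have k: "k1 \<notin> {a, b, c}" "k2 \<notin> {a, b, c}" "k3 \<notin> {a, b, c}"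
    and kk: "k1 \<noteq> k2" "k1 \<noteq> k3" "k2 \<noteq> k3" using assms by auto
  have u: "u \<in> quadric (confocal_matrix a b c k1)" "u \<in> quadric (confocal_matrix a b c k2)"
    "u \<in> quadric (confocal_matrix a b c k3)" using assms by simp_all
  have D: "D \<noteq> 0" using l(1) by (simp add: D_def)
  have ev: "ev1 = (l - k2) * (l - k3) / D" "ev2 = (l - k1) * (l - k3) / D"
    "ev3 = (l - k1) * (l - k2) / D"
    by (simp_all only: ev1_def ev2_def ev3_def D_def)
  have symA: "transpose (A m) = A m" for m by (simp add: A_def transpose_confocal_matrix)
  have symK: "transpose K = K" by (simp add: K_def transpose_tangent_cone_matrix symA)
  have s: "s - 1 = (l - k1) * (l - k2) * (l - k3) / D"
    unfolding s_def A_def D_def by (rule confocal_quadratic_form_factored[OF k kk l(1) u])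
  have quot: "(s - 1) / (l - k1) = ev1" "(s - 1) / (l - k2) = ev2" "(s - 1) / (l - k3) = ev3"
    using l by (simp_all add: s ev)
  have v1: "u \<bullet> ?v k1 = 1" "u \<bullet> ?v k2 = 1" "u \<bullet> ?v k3 = 1"
    using u by (simp_all add: A_def quadric_def)
  have nz: "?v k1 \<noteq> 0" "?v k2 \<noteq> 0" "?v k3 \<noteq> 0" using v1 by auto
  have eig: "K *v ?v k1 = ev1 *\<^sub>R ?v k1" "K *v ?v k2 = ev2 *\<^sub>R ?v k2" "K *v ?v k3 = ev3 *\<^sub>R ?v k3"
    using tangent_cone_matrix_confocal_eigenvector[OF k(1) l(1,2) u(1)]
      tangent_cone_matrix_confocal_eigenvector[OF k(2) l(1,3) u(2)]
      tangent_cone_matrix_confocal_eigenvector[OF k(3) l(1,4) u(3)]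
    unfolding A_def[symmetric] K_def[symmetric] s_def[symmetric] quot by simp_all
  have orth: "?v k1 \<bullet> ?v k2 = 0" "?v k1 \<bullet> ?v k3 = 0" "?v k2 \<bullet> ?v k3 = 0"
    unfolding A_def using confocal_normals_orthogonal k u kk by metis+
  have evnz: "ev1 \<noteq> 0" "ev2 \<noteq> 0" "ev3 \<noteq> 0" using l D by (simp_all add: ev)
  have evd: "ev1 \<noteq> ev2" "ev1 \<noteq> ev3" "ev2 \<noteq> ev3" using l D kk by (simp_all add: ev)
  have sgn: "\<not> (sgn ev1 = sgn ev2 \<and> sgn ev2 = sgn ev3) \<longleftrightarrow> k1 < l \<and> l < k3"
  proof -
    have "sgn ev1 = sgn ev2 \<longleftrightarrow> sgn (l - k2) = sgn (l - k1)"
      "sgn ev2 = sgn ev3 \<longleftrightarrow> sgn (l - k3) = sgn (l - k2)"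
      using l D by (simp_all add: ev sgn_mult sgn_divide sgn_eq_0_iff)
    moreover have "k1 < k2" "k2 < k3" using assms by simp_all
    ultimately show ?thesis using l by (auto simp: sgn_real_def split: if_splits)
  qed
  have plane: "tangent_plane (\<lambda>x. x \<bullet> (A m *v x)) u = {x. x \<bullet> ?v m = 1}" if "m \<in> {k1, k2, k3}" for m
  proof -
    have "u \<bullet> ?v m = 1" using that v1 by blast
    then show ?thesis by (simp only: tangent_plane_quadratic_form[OF symA])
  qed
  have cone: "real_cone u ?S \<and> \<not> circular_cone ?S
      \<and> {P. symmetry_plane P ?S} = {{x. x \<bullet> ?v k1 = 1}, {x. x \<bullet> ?v k2 = 1}, {x. x \<bullet> ?v k3 = 1}}"
    if indef: "\<not> (sgn ev1 = sgn ev2 \<and> sgn ev2 = sgn ev3)"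
  proof -
    have planes: "{P. symmetry_plane P ?S}
        = {{x. x \<bullet> ?v k1 = 1}, {x. x \<bullet> ?v k2 = 1}, {x. x \<bullet> ?v k3 = 1}}"
      by (simp add: symmetry_planes_of_cone[OF symK nz orth eig evnz indef evd] v1)
    then have "finite {P. symmetry_plane P ?S}" by (simp only: finite.intros)
    then have nc: "\<not> circular_cone ?S" using circular_cone_symmetry_planes by blast
    \<comment> \<open>A cone consisting of the apex alone would lie in a plane.\<close>
    have "\<exists>y. y \<bullet> (K *v y) = 0 \<and> y \<noteq> 0"
    proof (rule ccontr)
      assume "\<not> ?thesis"
      then have "(?v k1 \<bullet> y) * (?v k1 \<bullet> y) = 0" if "y \<bullet> (K *v y) = 0" for y
        using that by force
      then show False
        using two_planes_indefinite_cone[OF nz orth eig evnz indef, of "?v k1" "?v k1"] nz(1) by blast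
    qed
    then obtain y where y: "y \<bullet> (K *v y) = 0" "y \<noteq> 0" by blast
    have "u + y \<in> ?S" "u + y \<noteq> u" using y by (simp_all add: quadratic_cone_def)
    moreover have "u + t *\<^sub>R (x - u) \<in> ?S" if "x \<in> ?S" for x t
      using that by (simp add: quadratic_cone_def matrix_vector_mult_scaleR)
    ultimately have "real_cone u ?S" unfolding real_cone_def by blast
    with nc planes show ?thesis by blast
  qed
  show ?thesis
    using tangent_cone_eq_quadratic_cone[OF symA, of l u] nz eig evnz evd sgn plane cone
    unfolding K_def[symmetric] eigenvector_of_def by simp
qed

end
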